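(* Let $m,d$ be positive integers with $m>2d$. Then $\mathfrak{p}(m,d)=p_d(m)$. Consequently, $$\mathfrak{p}(m,d)=\frac{m-2d+1}{m-1}\binom{m-1}{d-1}=\#\mathcal{B}_{m-d,d-1}.$$
   Context: For a permutation $\pi=\pi_1\ldots\pi_n$ of $[n]=\{1,\dots,n\}$ in one-line notation, its pinnacle set is $\operatorname{Pin}\pi=\{\pi_i\mid 2\le i\le n-1,\ \pi_{i-1}<\pi_i>\pi_{i+1}\}$. Let $\mathcal{A}_n$ be the set of all $S$ such that $S=\operatorname{Pin}\pi$ for some permutation $\pi$ of $[n]$. Define $\mathfrak{p}(m,d)=\#\{S\in\mathcal{A}_n\mid \max S=m\text{ and }\#S=d\}$ where $n\ge m$ (the value does not depend on the choice of $n\ge m$). For a positive integer $d$, $p_d(m)$ is the polynomial in $m$ of degree $d-1$ given by $p_1(m)=1$ and, for $d\ge 2$, $$p_d(m)=\frac{m-2d+1}{(d-1)!}\prod_{i=2}^{d-1}(m-i),$$ where the product is $1$ for $d=2$. For nonnegative integers $p>q$, a $(p,q)$ ballot sequence is a sequence $\beta=\beta_1\beta_2\ldots\beta_{p+q}$ consisting of $p$ copies of the letter $X$ and $q$ copies of the letter $Y$ such that in every nonempty prefix $\beta_1\ldots\beta_i$ the number of $X$'s is strictly greater than the number of $Y$'s. $\mathcal{B}_{p,q}$ is the set of $(p,q)$ ballot sequences. *)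

theory Defs
  imports Complex_Main
    "HOL-Combinatorics.Permutations"
    "HOL-Computational_Algebra.Polynomial"
begin

text \<open>
  A permutation of \<open>[n]\<close> is a function \<open>\<pi>\<close> with \<open>\<pi> permutes {1..n}\<close>; its one-line notation
  is \<open>\<pi> 1, \<dots>, \<pi> n\<close>.
\<close>

definition Pin :: "nat \<Rightarrow> (nat \<Rightarrow> nat) \<Rightarrow> nat set" where
  "Pin n \<pi> = {\<pi> i | i. 2 \<le> i \<and> i \<le> n - 1 \<and> \<pi> (i - 1) < \<pi> i \<and> \<pi> i > \<pi> (i + 1)}"

definition admissible :: "nat \<Rightarrow> nat set set" where
  "admissible n = {S. \<exists>\<pi>. \<pi> permutes {1..n} \<and> S = Pin n \<pi>}"

text \<open>
  The number \<open>\<pp>(m,d)\<close>, with the auxiliary \<open>n \<ge> m\<close> kept as an explicit first argument instead of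
  being fixed by a choice. Only \<open>d \<ge> 1\<close> is meaningful: then \<open>S\<close> is nonempty and \<open>Max S\<close> is a
  genuine maximum.
\<close>

definition pin_count :: "nat \<Rightarrow> nat \<Rightarrow> nat \<Rightarrow> nat" where
  "pin_count n m d = card {S \<in> admissible n. Max S = m \<and> card S = d}"

text \<open>The polynomial \<open>p\<^sub>d\<close>, for \<open>d \<ge> 1\<close>; \<open>[:a, 1:]\<close> is the linear polynomial \<open>m + a\<close> in \<open>m\<close>.\<close>

definition pin_poly :: "nat \<Rightarrow> real poly" where
  "pin_poly d =
     (if d = 1 then 1
      else smult (1 / fact (d - 1)) ([:1 - 2 * real d, 1:] * (\<Prod>i = 2..d - 1. [:- real i, 1:])))"

lemma poly_pin_poly:
  "poly (pin_poly d) x =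
     (if d = 1 then 1 else (x - 2 * real d + 1) / fact (d - 1) * (\<Prod>i = 2..d - 1. (x - real i)))"
  by (simp add: pin_poly_def poly_prod add_divide_distrib diff_divide_distrib algebra_simps)

lemma degree_pin_poly:
  assumes "d \<ge> 1"
  shows "degree (pin_poly d) = d - 1"
proof (cases "d = 1")
  case False
  then have "degree (\<Prod>i = 2..d - 1. [:- real i, 1:]) = d - 2"
    by (subst degree_prod_eq_sum_degree) auto
  moreover have "(\<Prod>i = 2..d - 1. [:- real i, 1:]) \<noteq> 0"
    by auto
  ultimately show ?thesis
    using False assms by (simp add: pin_poly_def degree_mult_eq del: mult_pCons_left)
qed (simp add: pin_poly_def)

datatype letter = X | Y

definition ballot_seqs :: "nat \<Rightarrow> nat \<Rightarrow> letter list set" where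
  "ballot_seqs p q = {\<beta>. count_list \<beta> X = p \<and> count_list \<beta> Y = q \<and>
     (\<forall>i. 1 \<le> i \<and> i \<le> length \<beta> \<longrightarrow> count_list (take i \<beta>) X > count_list (take i \<beta>) Y)}"

end

theory Submission
  imports Defs
begin

text \<open>
  A set \<open>S \<subseteq> {1..n}\<close> is a pinnacle set iff every initial segment \<open>{1..k}\<close> contains more
  non-elements than elements of \<open>S\<close>. Necessity: the right neighbours of the pinnacles that are at
  most \<open>k\<close>, together with the left neighbour of the first of them, are smaller non-pinnacles.
  Sufficiency: interleave the elements \<open>s\<^sub>1 < s\<^sub>2 < \<dots>\<close> of \<open>S\<close> with the non-elements
  \<open>u\<^sub>1 < u\<^sub>2 < \<dots>\<close> as \<open>u\<^sub>1 s\<^sub>1 u\<^sub>2 s\<^sub>2 \<dots>\<close>. Reading the non-elements below \<open>Max S\<close> as \<open>X\<close> and the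
  elements as \<open>Y\<close> turns this criterion into the ballot condition.
\<close>

section \<open>Pinnacle sets\<close>

lemma Pin_subset:
  assumes "\<pi> permutes {1..n}"
  shows "Pin n \<pi> \<subseteq> {1..n}"
  using permutes_in_image[OF assms] unfolding Pin_def by fastforce

text \<open>Positions are counted instead of values. If \<open>P\<close> holds the positions of the
  pinnacles of value at most \<open>k\<close>, then the successors of \<open>P\<close> and the
  position before \<open>Min P\<close> make \<open>card P + 1\<close> distinct positions. Each is
  adjacent to a position in \<open>P\<close>, so its value is smaller and is not a pinnacle.\<close>

lemma Pin_prefix_card:
  assumes perm: "\<pi> permutes {1..n}" and k: "1 \<le> k" "k \<le> n"
  shows "card (Pin n \<pi> \<inter> {1..k}) < card ({1..k} - Pin n \<pi>)"
proof -
  define P where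
    "P = {i. 2 \<le> i \<and> i \<le> n - 1 \<and> \<pi> (i - 1) < \<pi> i \<and> \<pi> i > \<pi> (i + 1) \<and> \<pi> i \<le> k}"
  have finP: "finite P"
    by (rule finite_subset[of _ "{..n}"]) (auto simp: P_def)
  have inj: "inj \<pi>"
    using perm by (rule permutes_inj)
  have pos: "1 \<le> \<pi> i" if "1 \<le> i" "i \<le> n" for i
    using permutes_in_image[OF perm, of i] that by simp
  have S: "Pin n \<pi> \<inter> {1..k} = \<pi> ` P"
    using pos unfolding P_def Pin_def by fastforce
  have cardS: "card (Pin n \<pi> \<inter> {1..k}) = card P"
    unfolding S using inj by (simp add: card_image inj_on_def)
  \<comment> \<open>By injectivity the value \<open>\<pi> j\<close> occurs only at \<open>j\<close>,
    so membership in the pinnacle set is a local question at \<open>j\<close>.\<close>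
  have notPin: "\<pi> j \<notin> Pin n \<pi>" if "\<not> (\<pi> (j - 1) < \<pi> j \<and> \<pi> j > \<pi> (j + 1))" for j
    using that injD[OF inj] unfolding Pin_def by auto
  show ?thesis
  proof (cases "P = {}")
    case True
    then have "1 \<in> {1..k} - Pin n \<pi>" "card (Pin n \<pi> \<inter> {1..k}) = 0"
      using S cardS k by auto
    then show ?thesis
      by (metis card_gt_0_iff empty_iff finite_Diff finite_atLeastAtMost)
  next
    case False
    define a where "a = Min P"
    have a: "a \<in> P" and amin: "\<And>i. i \<in> P \<Longrightarrow> a \<le> i"
      using False finP by (auto simp: a_def)
    have a2: "2 \<le> a"
      using a by (simp add: P_def)
    let ?Q = "insert (a - 1) (Suc ` P)"
    \<comment> \<open>Otherwise \<open>a - 2\<close> would be an element of \<open>P\<close> below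
      its minimum.\<close>
    have "a - 1 \<notin> Suc ` P"
      using amin a2 by force
    then have cardQ: "card ?Q = Suc (card P)"
      using finP by (simp add: card_image)
    have "\<pi> ` ?Q \<subseteq> {1..k} - Pin n \<pi>"
    proof
      fix y assume "y \<in> \<pi> ` ?Q"
      then consider "y = \<pi> (a - 1)" | i where "i \<in> P" "y = \<pi> (Suc i)"
        by auto
      then show "y \<in> {1..k} - Pin n \<pi>"
      proof cases
        case 1
        have "\<pi> (a - 1) < \<pi> (a - 1 + 1)" "\<pi> (a - 1) \<le> k" "a \<le> n - 1"
          using a a2 by (auto simp: P_def)
        moreover from this have "1 \<le> \<pi> (a - 1)"
          using a2 by (intro pos) auto
        ultimately show ?thesis
          using 1 notPin[of "a - 1"] by auto
      next
        case 2
        have "\<pi> (Suc i) < \<pi> (Suc i - 1)" "\<pi> (Suc i) \<le> k" "2 \<le> i" "i \<le> n - 1"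
          using 2 by (auto simp: P_def)
        moreover from this have "1 \<le> \<pi> (Suc i)"
          by (intro pos) auto
        ultimately show ?thesis
          using 2 notPin[of "Suc i"] by auto
      qed
    qed
    then have "card (\<pi> ` ?Q) \<le> card ({1..k} - Pin n \<pi>)"
      by (intro card_mono) auto
    moreover have "card (\<pi> ` ?Q) = card ?Q"
      using inj by (intro card_image) (auto simp: inj_on_def)
    ultimately show ?thesis
      using cardQ cardS by linarith
  qed
qed

section \<open>Increasing enumeration of a finite set\<close>

lemma nth_sorted_list_mono:
  fixes A :: "nat set"
  assumes "i < j" "j < card A"
  shows "sorted_list_of_set A ! i < sorted_list_of_set A ! j"
  using assms sorted_wrt_nth_less[OF strict_sorted_list_of_set[of A]] by simp

lemma nth_sorted_list_mem:
  assumes "finite A" "i < card A"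
  shows "sorted_list_of_set A ! i \<in> A"
  using assms by (metis length_sorted_list_of_set nth_mem set_sorted_list_of_set)

text \<open>The elements below the entry at index \<open>i\<close> are exactly the entries at
  smaller indices. This links positions in the enumeration to the cardinalities in the prefix
  condition.\<close>

lemma card_below_nth_sorted_list:
  fixes A :: "nat set"
  assumes "finite A" "i < card A"
  shows "card {x \<in> A. x < sorted_list_of_set A ! i} = i"
proof -
  let ?l = "sorted_list_of_set A"
  have "{x \<in> A. x < ?l ! i} = (\<lambda>j. ?l ! j) ` {..<i}"
  proof (intro equalityI subsetI)
    fix x assume x: "x \<in> {x \<in> A. x < ?l ! i}"
    then have "x \<in> set ?l"
      using assms by simp
    then obtain j where j: "j < card A" "x = ?l ! j"
      by (metis in_set_conv_nth length_sorted_list_of_set)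
    moreover have "j < i"
      using x j nth_sorted_list_mono[of i j A] by (metis less_asym' less_linear mem_Collect_eq)
    ultimately show "x \<in> (\<lambda>j. ?l ! j) ` {..<i}"
      by auto
  next
    fix x assume "x \<in> (\<lambda>j. ?l ! j) ` {..<i}"
    then show "x \<in> {x \<in> A. x < ?l ! i}"
      using assms by (auto intro: nth_sorted_list_mono nth_sorted_list_mem)
  qed
  moreover have "inj_on (\<lambda>j. ?l ! j) {..<i}"
    using assms by (intro inj_onI) (simp add: nth_eq_iff_index_eq)
  ultimately show ?thesis
    by (simp add: card_image)
qed

section \<open>The interleaving permutation\<close>

text \<open>Positions 2, 4, ..., \<open>2 * card S\<close> receive \<open>S\<close> in increasing
  order. All other positions receive the complement in increasing order, so everything beyond
  \<open>2 * card S\<close> forms an increasing tail. List indices start at 0 and positions at 1.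
  Outside \<open>{1..n}\<close> the map is the identity, as \<open>permutes\<close> demands.\<close>

definition interleave :: "nat \<Rightarrow> nat set \<Rightarrow> nat \<Rightarrow> nat" where
  "interleave n S i =
     (let s = sorted_list_of_set S; u = sorted_list_of_set ({1..n} - S)
      in if i \<notin> {1..n} then i
         else if 2 * card S < i then u ! (i - card S - 1)
         else if even i then s ! (i div 2 - 1)
         else u ! (i div 2))"

text \<open>The positions in \<open>E\<close> go injectively into \<open>S\<close> and the others
  injectively into the complement, so the whole map is an injective self-map of a finite set. The
  bound \<open>small\<close> keeps every list index in range.\<close>

lemma interleave_permutes:
  assumes S: "S \<subseteq> {1..n}" and small: "2 * card S \<le> n"
  shows "interleave n S permutes {1..n}"
proof -
  let ?U = "{1..n} - S"
  let ?s = "sorted_list_of_set S" and ?u = "sorted_list_of_set ?U"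
  have fin: "finite S" "finite ?U"
    using S finite_subset by auto
  have cardU: "card ?U = n - card S"
    using S fin by (simp add: card_Diff_subset)
  \<comment> \<open>The index into \<open>u\<close> used at a position outside \<open>E\<close>. The
    two formulas agree at \<open>2 * card S + 1\<close>, where both give
    \<open>card S\<close>.\<close>
  define g where "g i = (if 2 * card S < i then i - card S - 1 else i div 2)" for i
  define E where "E i \<longleftrightarrow> i \<le> 2 * card S \<and> even i" for i
  have onE: "interleave n S i = ?s ! (i div 2 - 1)" "i div 2 - 1 < card S" "1 \<le> i div 2"
    if "i \<in> {1..n}" "E i" for i
    using that by (auto simp: interleave_def E_def Let_def elim!: evenE)
  have onU: "interleave n S i = ?u ! g i" "g i < card ?U" if "i \<in> {1..n}" "\<not> E i" for i
    using that small cardU by (auto simp: interleave_def E_def g_def Let_def elim!: oddE)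
  have g_inj: "i = j" if "i \<in> {1..n}" "j \<in> {1..n}" "\<not> E i" "\<not> E j" "g i = g j" for i j
    using that unfolding E_def g_def by (auto split: if_splits elim!: oddE)
  have memS: "interleave n S i \<in> S" if "i \<in> {1..n}" "E i" for i
    using onE[OF that] nth_sorted_list_mem[OF fin(1)] by simp
  have memU: "interleave n S i \<in> ?U" if "i \<in> {1..n}" "\<not> E i" for i
    using onU[OF that] nth_sorted_list_mem[OF fin(2)] by simp
  have inj: "inj_on (interleave n S) {1..n}"
  proof (rule inj_onI)
    fix i j assume i: "i \<in> {1..n}" and j: "j \<in> {1..n}"
      and eq: "interleave n S i = interleave n S j"
    show "i = j"
    proof (cases "E i")
      case True
      have Ej: "E j"
        using memS[OF i True] memU[OF j] eq by auto
      have "?s ! (i div 2 - 1) = ?s ! (j div 2 - 1)"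
        using eq onE[OF i True] onE[OF j Ej] by simp
      then have "i div 2 - 1 = j div 2 - 1"
        using onE[OF i True] onE[OF j Ej] by (simp add: nth_eq_iff_index_eq)
      then have "i div 2 = j div 2"
        using onE(3)[OF i True] onE(3)[OF j Ej] by linarith
      then show ?thesis
        using True Ej by (auto simp: E_def elim!: evenE)
    next
      case False
      have Ej: "\<not> E j"
        using memS[OF j] memU[OF i False] eq by auto
      have "?u ! g i = ?u ! g j"
        using eq onU[OF i False] onU[OF j Ej] by simp
      then have "g i = g j"
        using onU[OF i False] onU[OF j Ej] by (simp add: nth_eq_iff_index_eq)
      then show ?thesis
        using g_inj i j False Ej by blast
    qed
  qed
  have "interleave n S ` {1..n} \<subseteq> {1..n}"
    using memS memU S by blast
  then have "bij_betw (interleave n S) {1..n} {1..n}"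
    using inj endo_inj_surj[of "{1..n}"] by (simp add: bij_betw_def)
  then show ?thesis
    by (rule bij_imp_permutes) (simp add: interleave_def)
qed

text \<open>The prefix condition at an element of \<open>S\<close> places enough non-elements below
  it to make it larger than both of its neighbours. No other position is a peak: the tail increases,
  and every earlier odd position is followed by a larger value.\<close>

lemma Pin_interleave:
  assumes S: "S \<subseteq> {1..n}"
    and prefix: "\<And>k. k \<in> S \<Longrightarrow> card (S \<inter> {1..k}) < card ({1..k} - S)"
    and small: "2 * card S \<le> n"
  shows "Pin n (interleave n S) = S"
proof -
  let ?U = "{1..n} - S" and ?\<pi> = "interleave n S"
  let ?s = "sorted_list_of_set S" and ?u = "sorted_list_of_set ?U"
  have fin: "finite S" "finite ?U"
    using S finite_subset by auto
  have cardU: "card ?U = n - card S"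
    using S fin by (simp add: card_Diff_subset)
  have u_less: "Suc j < card ?U \<and> ?u ! Suc j < ?s ! j" if j: "j < card S" for j
  proof -
    let ?x = "?s ! j"
    have x: "?x \<in> S"
      using nth_sorted_list_mem[OF fin(1) j] .
    have "S \<inter> {1..?x} = insert ?x {y \<in> S. y < ?x}"
      using S x by auto
    then have cS: "card (S \<inter> {1..?x}) = Suc j"
      using card_below_nth_sorted_list[OF fin(1) j] fin by simp
    have xU: "{1..?x} - S = {y \<in> ?U. y < ?x}"
      using S x by (auto simp: order.strict_iff_order)
    \<comment> \<open>The prefix ending at \<open>?s ! j\<close> has \<open>j + 1\<close> elements
      of \<open>S\<close>, hence at least \<open>j + 2\<close> non-elements. So the non-element of
      index \<open>j + 1\<close> must lie below \<open>?s ! j\<close>, by its rank.\<close>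
    have c: "Suc j < card {y \<in> ?U. y < ?x}"
      using prefix[OF x] cS xU by simp
    also have "\<dots> \<le> card ?U"
      by (intro card_mono) auto
    finally have jU: "Suc j < card ?U" .
    moreover have "?u ! Suc j < ?x"
    proof (rule ccontr)
      assume "\<not> ?u ! Suc j < ?x"
      then have "card {y \<in> ?U. y < ?x} \<le> card {y \<in> ?U. y < ?u ! Suc j}"
        by (intro card_mono) auto
      then show False
        using card_below_nth_sorted_list[OF fin(2) jU] c by simp
    qed
    ultimately show ?thesis
      by simp
  qed
  have ev: "?\<pi> (2 * j + 2) = ?s ! j" if "j < card S" for j
    using that small by (simp add: interleave_def)
  have od: "?\<pi> (2 * j + 1) = ?u ! j" if "j \<le> card S" "2 * j + 1 \<le> n" for j
    using that by (cases "j = card S") (simp_all add: interleave_def)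
  have tail: "?\<pi> i = ?u ! (i - card S - 1)" if "2 * card S < i" "i \<le> n" for i
    using that by (simp add: interleave_def)
  have peak: "2 * j + 2 \<le> n - 1 \<and> ?\<pi> (2 * j + 1) < ?\<pi> (2 * j + 2) \<and> ?\<pi> (2 * j + 3) < ?\<pi> (2 * j + 2)"
    if j: "j < card S" for j
  proof -
    \<comment> \<open>\<open>u_less\<close> at the last element of \<open>S\<close> sharpens
      \<open>small\<close> by one: the last peak has a right neighbour.\<close>
    have n: "2 * card S + 1 \<le> n"
      using u_less[of "card S - 1"] j cardU by (simp, linarith)
    have "?\<pi> (2 * Suc j + 1) = ?u ! Suc j" "?\<pi> (2 * j + 1) = ?u ! j"
      using j n by (intro od; simp)+
    then show ?thesis
      using u_less[OF j] ev[OF j] nth_sorted_list_mono[of j "Suc j" ?U] j n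
      by (simp add: eval_nat_numeral)
  qed
  show ?thesis
  proof (intro equalityI subsetI)
    fix x assume "x \<in> S"
    then have "x \<in> set ?s"
      using fin by simp
    then obtain j where j: "j < card S" "x = ?s ! j"
      by (metis in_set_conv_nth length_sorted_list_of_set)
    show "x \<in> Pin n ?\<pi>"
      unfolding Pin_def using peak[OF j(1)] ev[OF j(1)] j(2)
      by (intro CollectI exI[of _ "2 * j + 2"]) (simp add: eval_nat_numeral)
  next
    fix x assume "x \<in> Pin n ?\<pi>"
    then obtain i where i: "x = ?\<pi> i" "2 \<le> i" "i \<le> n - 1" "?\<pi> (i - 1) < ?\<pi> i" "?\<pi> i > ?\<pi> (i + 1)"
      unfolding Pin_def by blast
    have le: "i \<le> 2 * card S"
    proof (rule ccontr)
      assume "\<not> i \<le> 2 * card S"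
      then have "2 * card S < i" "i + 1 \<le> n" "i - card S - 1 < i - card S" "i - card S < card ?U"
        using i(2,3) cardU by linarith+
      then have "?\<pi> i < ?\<pi> (i + 1)"
        using tail[of i] tail[of "i + 1"] nth_sorted_list_mono[of "i - card S - 1" "i - card S" ?U]
        by simp
      then show False
        using i by simp
    qed
    have "even i"
    proof (rule ccontr)
      assume "odd i"
      then obtain j where "i = 2 * j + 1"
        by (elim oddE)
      then show False
        using peak[of j] i le by simp
    qed
    then obtain j where "i = 2 * j"
      by (elim evenE)
    then obtain j' where "i = 2 * j' + 2"
      using i by (cases j) auto
    then show "x \<in> S"
      using ev[of j'] le i nth_sorted_list_mem[OF fin(1)] by simp
  qed
qed

theorem admissible_iff:
  "S \<in> admissible n \<longleftrightarrow>
     S \<subseteq> {1..n} \<and> (\<forall>k\<in>{1..n}. card (S \<inter> {1..k}) < card ({1..k} - S))"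
  (is "_ \<longleftrightarrow> ?R")
proof
  assume "S \<in> admissible n"
  then show ?R
    unfolding admissible_def using Pin_subset Pin_prefix_card by auto
next
  assume R: ?R
  \<comment> \<open>This is the condition at \<open>k = n\<close>. For \<open>n = 0\<close> there is
    no such \<open>k\<close>, but then \<open>S\<close> is empty.\<close>
  have small: "2 * card S \<le> n"
  proof (cases "n = 0")
    case False
    then have "card (S \<inter> {1..n}) < card ({1..n} - S)"
      using R by simp
    moreover have "S \<inter> {1..n} = S" "card ({1..n} - S) = n - card S"
      using R finite_subset[of S "{1..n}"] by (auto simp: card_Diff_subset)
    ultimately show ?thesis
      by simp
  qed (use R in auto)
  have "interleave n S permutes {1..n}"
    using R small by (intro interleave_permutes) auto
  moreover have "Pin n (interleave n S) = S"
    using R small by (intro Pin_interleave) auto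
  ultimately show "S \<in> admissible n"
    unfolding admissible_def by auto
qed

section \<open>Ballot sequences\<close>

lemma count_list_letters: "count_list \<beta> X + count_list \<beta> Y = length \<beta>"
proof (induction \<beta>)
  case (Cons a \<beta>)
  then show ?case by (cases a) auto
qed simp

lemma count_list_map_upt:
  "count_list (map f [1..<Suc k]) y = card {i \<in> {1..k}. f i = y}"
proof (induction k)
  case (Suc k)
  have "{i \<in> {1..Suc k}. f i = y} = {i \<in> {1..k}. f i = y} \<union> (if f (Suc k) = y then {Suc k} else {})"
    by (auto simp: le_Suc_eq)
  then show ?case
    using Suc by simp
qed simp

lemma ballot_seqs_length: "\<beta> \<in> ballot_seqs p q \<Longrightarrow> length \<beta> = p + q"
  using count_list_letters[of \<beta>] by (simp add: ballot_seqs_def)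

lemma finite_ballot_seqs: "finite (ballot_seqs p q)"
proof (rule finite_subset)
  show "ballot_seqs p q \<subseteq> {\<beta>. set \<beta> \<subseteq> {X, Y} \<and> length \<beta> = p + q}"
    by (auto dest: ballot_seqs_length) (metis letter.exhaust)
  show "finite {\<beta>. set \<beta> \<subseteq> {X, Y} \<and> length \<beta> = p + q}"
    by (intro finite_lists_length_eq) auto
qed

text \<open>Since \<open>q < p\<close>, the condition on the full word follows from its letter
  counts, so only the prefixes of \<beta> impose anything further. The conjunct \<open>0 < q\<close>
  guards against truncation in \<open>q - 1\<close>.\<close>

lemma snoc_in_ballot_seqs:
  assumes "q < p"
  shows "\<beta> @ [a] \<in> ballot_seqs p q \<longleftrightarrow>
           (case a of X \<Rightarrow> \<beta> \<in> ballot_seqs (p - 1) q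
                    | Y \<Rightarrow> 0 < q \<and> \<beta> \<in> ballot_seqs p (q - 1))"
proof -
  define good where
    "good \<gamma> \<longleftrightarrow> (\<forall>i. 1 \<le> i \<and> i \<le> length \<gamma> \<longrightarrow> count_list (take i \<gamma>) X > count_list (take i \<gamma>) Y)"
    for \<gamma>
  have "good (\<beta> @ [a]) \<longleftrightarrow> good \<beta> \<and> count_list (\<beta> @ [a]) X > count_list (\<beta> @ [a]) Y"
  proof
    assume g: "good (\<beta> @ [a])"
    have "good \<beta>"
      unfolding good_def
    proof (intro allI impI)
      fix i assume i: "1 \<le> i \<and> i \<le> length \<beta>"
      then have "take i (\<beta> @ [a]) = take i \<beta>" by simp
      then show "count_list (take i \<beta>) Y < count_list (take i \<beta>) X"
        using g i unfolding good_def by (metis le_SucI length_append_singleton)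
    qed
    moreover have "count_list (take (length (\<beta> @ [a])) (\<beta> @ [a])) Y
        < count_list (take (length (\<beta> @ [a])) (\<beta> @ [a])) X"
      using g unfolding good_def by (metis Suc_le_mono le0 One_nat_def le_refl length_append_singleton)
    ultimately show "good \<beta> \<and> count_list (\<beta> @ [a]) X > count_list (\<beta> @ [a]) Y"
      by simp
  next
    assume "good \<beta> \<and> count_list (\<beta> @ [a]) X > count_list (\<beta> @ [a]) Y"
    then show "good (\<beta> @ [a])"
      unfolding good_def by (auto simp: le_Suc_eq)
  qed
  moreover have "\<gamma> \<in> ballot_seqs p q \<longleftrightarrow> count_list \<gamma> X = p \<and> count_list \<gamma> Y = q \<and> good \<gamma>" for \<gamma> p q
    by (simp add: ballot_seqs_def good_def)
  ultimately show ?thesis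
    using assms by (cases a) auto
qed

text \<open>The whole word is a nonempty prefix with equally many letters of both kinds. This is a
  boundary case of the recursion below.\<close>

lemma ballot_seqs_diag: "0 < p \<Longrightarrow> ballot_seqs p p = {}"
proof -
  assume p: "0 < p"
  have False if "\<beta> \<in> ballot_seqs p p" for \<beta>
    using that ballot_seqs_length[OF that] p unfolding ballot_seqs_def
    by (auto dest!: spec[of _ "length \<beta>"])
  then show ?thesis by blast
qed

lemma ballot_seqs_0: "ballot_seqs p 0 = {replicate p X}"
proof (intro equalityI subsetI)
  fix \<beta> assume b: "\<beta> \<in> ballot_seqs p 0"
  then have "Y \<notin> set \<beta>"
    by (simp add: ballot_seqs_def count_list_0_iff)
  then have "\<forall>x\<in>set \<beta>. x = X"
    by (metis letter.exhaust)
  then show "\<beta> \<in> {replicate p X}"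
    using ballot_seqs_length[OF b] by (simp add: replicate_eqI)
next
  have "count_list (replicate k X) X = k \<and> count_list (replicate k X) Y = 0" for k
    by (induction k) auto
  moreover fix \<beta> assume "\<beta> \<in> {replicate p X}"
  ultimately show "\<beta> \<in> ballot_seqs p 0"
    by (simp add: ballot_seqs_def)
qed

text \<open>Words are split by their last letter.\<close>

lemma card_ballot_seqs_rec:
  assumes "q < p" "0 < q"
  shows "card (ballot_seqs p q) = card (ballot_seqs (p - 1) q) + card (ballot_seqs p (q - 1))"
proof -
  let ?A = "(\<lambda>\<beta>. \<beta> @ [X]) ` ballot_seqs (p - 1) q" and ?B = "(\<lambda>\<beta>. \<beta> @ [Y]) ` ballot_seqs p (q - 1)"
  have "ballot_seqs p q = ?A \<union> ?B"
  proof (intro equalityI subsetI)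
    fix \<beta> assume b: "\<beta> \<in> ballot_seqs p q"
    then have "\<beta> \<noteq> []"
      using ballot_seqs_length[OF b] assms by auto
    then obtain \<gamma> a where "\<beta> = \<gamma> @ [a]"
      by (metis append_butlast_last_id)
    then show "\<beta> \<in> ?A \<union> ?B"
      using b snoc_in_ballot_seqs[OF assms(1), of \<gamma> a] by (cases a) auto
  next
    fix \<beta> assume "\<beta> \<in> ?A \<union> ?B"
    then show "\<beta> \<in> ballot_seqs p q"
      using snoc_in_ballot_seqs[OF assms(1)] assms(2) by auto
  qed
  moreover have "card (?A \<union> ?B) = card ?A + card ?B"
    by (intro card_Un_disjoint) (auto simp: finite_ballot_seqs)
  moreover have "card ?A = card (ballot_seqs (p - 1) q)" "card ?B = card (ballot_seqs p (q - 1))"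
    by (auto intro!: card_image inj_onI)
  ultimately show ?thesis
    by simp
qed

text \<open>The ballot theorem, by induction on the length through the last-letter recursion. The
  diagonal \<open>p = q\<close>, where both sides vanish, is included so that the induction
  hypothesis covers \<open>(p - 1, q)\<close> when \<open>p = q + 1\<close>.\<close>

theorem card_ballot_seqs:
  assumes "q \<le> p" "0 < p"
  shows "real (card (ballot_seqs p q)) = (real p - real q) / real (p + q) * real ((p + q) choose q)"
  using assms
proof (induction "p + q" arbitrary: p q rule: less_induct)
  case less
  show ?case
  proof (cases "q = 0 \<or> p = q")
    case True
    then show ?thesis
      using less.prems by (auto simp: ballot_seqs_0 ballot_seqs_diag)
  next
    case False
    then have qp: "q < p" "0 < q"
      using less.prems by auto
    define P Q C where "P = real p" and "Q = real q" and "C = real ((p + q) choose q)"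
    obtain q' where q': "q = Suc q'"
      using qp gr0_conv_Suc by blast
    \<comment> \<open>Absorption and then Pascal's rule write both smaller binomials as multiples of
      \<open>C\<close>.\<close>
    have "q * ((p + q) choose q) = (p + q) * ((p + q - 1) choose (q - 1))"
      using Suc_times_binomial_eq[of "p + q'" q'] q' by (simp add: mult.commute)
    then have c1: "real ((p + q - 1) choose (q - 1)) = Q * C / (P + Q)"
      using qp unfolding P_def Q_def C_def
      by (simp add: field_simps flip: of_nat_mult of_nat_add)
    have "(p + q) choose q = ((p + q - 1) choose (q - 1)) + ((p + q - 1) choose q)"
      using q' by simp
    then have c2: "real ((p + q - 1) choose q) = P * C / (P + Q)"
      using c1 qp unfolding P_def Q_def C_def by (simp add: field_simps)
    have "real (card (ballot_seqs (p - 1) q))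
        = (real (p - 1) - real q) / real (p - 1 + q) * real ((p - 1 + q) choose q)"
      using qp by (intro less.hyps) auto
    moreover have "p - 1 + q = p + q - 1"
      using qp by simp
    ultimately have b1: "real (card (ballot_seqs (p - 1) q)) = (P - 1 - Q) / (P + Q - 1) * (P * C / (P + Q))"
      using c2 qp unfolding P_def Q_def by (simp add: of_nat_diff)
    have "real (card (ballot_seqs p (q - 1)))
        = (real p - real (q - 1)) / real (p + (q - 1)) * real ((p + (q - 1)) choose (q - 1))"
      using qp by (intro less.hyps) auto
    moreover have "p + (q - 1) = p + q - 1" "real p - real (q - 1) = P - Q + 1"
      "real (p + q - 1) = P + Q - 1"
      using qp unfolding P_def Q_def by (auto simp: of_nat_diff)
    ultimately have b2: "real (card (ballot_seqs p (q - 1))) = (P - Q + 1) / (P + Q - 1) * (Q * C / (P + Q))"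
      using c1 by simp
    have nz: "P + Q - 1 \<noteq> 0" "P + Q \<noteq> 0"
      using qp unfolding P_def Q_def by auto
    \<comment> \<open>The numerators combine by
      \<open>(P - 1 - Q) * P + (P - Q + 1) * Q = (P - Q) * (P + Q - 1)\<close>.\<close>
    have "(P - 1 - Q) / (P + Q - 1) * (P * C / (P + Q)) + (P - Q + 1) / (P + Q - 1) * (Q * C / (P + Q))
        = ((P - Q) * (P + Q - 1)) * C / ((P + Q - 1) * (P + Q))"
      by (simp add: algebra_simps flip: add_divide_distrib)
    also have "\<dots> = (P - Q) / (P + Q) * C"
      using nz by simp
    finally show ?thesis
      using card_ballot_seqs_rec[OF qp] b1 b2 by (simp add: P_def Q_def C_def)
  qed
qed

section \<open>Counting pinnacle sets\<close>

text \<open>The maximum \<open>m\<close> is fixed, so \<open>S\<close> is determined by its part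
  below \<open>m\<close>, which is encoded as a word of length \<open>m - 1\<close> with
  \<open>d - 1\<close> letters \<open>Y\<close>. Prefixes with \<open>k < m\<close> give the ballot
  condition; those with \<open>m \<le> k\<close> hold by \<open>2 * d < m\<close>, whatever
  \<open>n\<close> is.\<close>

lemma pin_count_eq_card_ballot_seqs:
  assumes d: "0 < d" and m: "2 * d < m" and n: "m \<le> n"
  shows "pin_count n m d = card (ballot_seqs (m - d) (d - 1))"
proof -
  let ?A = "{S \<in> admissible n. Max S = m \<and> card S = d}"
  define word where "word S = map (\<lambda>i. if i \<in> S then Y else X) [1..<m]" for S
  \<comment> \<open>The inverse of \<open>word\<close>: it puts the omitted \<open>m\<close> back,
    and letter \<open>i\<close> sits at list index \<open>i - 1\<close>.\<close>
  define set_of where "set_of \<beta> = insert m {i \<in> {1..<m}. \<beta> ! (i - 1) = Y}" for \<beta>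
  have take_word: "take k (word S) = map (\<lambda>i. if i \<in> S then Y else X) [1..<Suc k]"
    if "k < m" for k S
    using that by (simp add: word_def take_map take_upt)
  have counts: "count_list (take k (word S)) Y = card (S \<inter> {1..k})"
    "count_list (take k (word S)) X = card ({1..k} - S)" if "k < m" for k S
    unfolding take_word[OF that] count_list_map_upt
    by (auto intro!: arg_cong[where f = card] split: if_splits)
  have len_word: "length (word S) = m - 1" for S
    by (simp add: word_def)
  have ballot_word: "word S \<in> ballot_seqs (m - d) (d - 1) \<longleftrightarrow>
      card ({1..m - 1} - S) = m - d \<and> card (S \<inter> {1..m - 1}) = d - 1 \<and>
      (\<forall>k\<in>{1..m - 1}. card (S \<inter> {1..k}) < card ({1..k} - S))" for S
  proof -
    have "take (m - 1) (word S) = word S"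
      by (simp add: word_def)
    then have "count_list (word S) Y = card (S \<inter> {1..m - 1})"
      "count_list (word S) X = card ({1..m - 1} - S)"
      using counts[of "m - 1" S] m by simp_all
    moreover have "count_list (take k (word S)) Y < count_list (take k (word S)) X
        \<longleftrightarrow> card (S \<inter> {1..k}) < card ({1..k} - S)" if "k \<le> m - 1" for k
      using counts[of k S] that m by simp
    ultimately show ?thesis
      unfolding ballot_seqs_def by (auto simp: len_word)
  qed
  have "bij_betw word ?A (ballot_seqs (m - d) (d - 1))"
  proof (rule bij_betw_byWitness[where f' = set_of])
    have A: "finite S" "m \<in> S" "S \<subseteq> {1..m}" if "S \<in> ?A" for S
    proof -
      have S: "S \<subseteq> {1..n}" "Max S = m" "card S = d"
        using that by (auto simp: admissible_iff)
      then show fin: "finite S"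
        using finite_subset by blast
      have "S \<noteq> {}"
        using S d by auto
      then show "m \<in> S"
        using fin S Max_in by blast
      show "S \<subseteq> {1..m}"
        using S fin Max_ge by fastforce
    qed
    show "\<forall>S\<in>?A. set_of (word S) = S"
    proof
      fix S assume S: "S \<in> ?A"
      have "word S ! (i - 1) = Y \<longleftrightarrow> i \<in> S" if "i \<in> {1..<m}" for i
        using that nth_map[of "i - 1" "[1..<m]"] by (simp add: word_def less_diff_iff)
      then have "set_of (word S) = insert m {i \<in> {1..<m}. i \<in> S}"
        unfolding set_of_def by blast
      also have "\<dots> = S"
        using A(2,3)[OF S] by (auto simp: le_less)
      finally show "set_of (word S) = S" .
    qed
    show "\<forall>\<beta>\<in>ballot_seqs (m - d) (d - 1). word (set_of \<beta>) = \<beta>"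
    proof
      fix \<beta> assume "\<beta> \<in> ballot_seqs (m - d) (d - 1)"
      then have "length \<beta> = m - 1"
        using ballot_seqs_length d m by fastforce
      then show "word (set_of \<beta>) = \<beta>"
        by (intro nth_equalityI) (auto simp: word_def set_of_def, metis letter.exhaust)
    qed
    show "word ` ?A \<subseteq> ballot_seqs (m - d) (d - 1)"
    proof
      fix \<beta> assume "\<beta> \<in> word ` ?A"
      then obtain S where S: "S \<in> ?A" "\<beta> = word S"
        by blast
      have eq: "S \<inter> {1..m - 1} = S - {m}"
        using A(2,3)[OF S(1)] by force
      have c: "card (S \<inter> {1..m - 1}) = d - 1"
        unfolding eq using A(1,2)[OF S(1)] S(1) by simp
      have "card ({1..m - 1} - S) = m - 1 - card (S \<inter> {1..m - 1})"
        by (simp add: card_Diff_subset_Int Int_commute)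
      then have "card ({1..m - 1} - S) = m - d"
        using c d m by simp
      moreover have "\<forall>k\<in>{1..m - 1}. card (S \<inter> {1..k}) < card ({1..k} - S)"
        using S(1) n by (auto simp: admissible_iff)
      ultimately show "\<beta> \<in> ballot_seqs (m - d) (d - 1)"
        using c ballot_word S(2) by blast
    qed
    show "set_of ` ballot_seqs (m - d) (d - 1) \<subseteq> ?A"
    proof
      fix S assume "S \<in> set_of ` ballot_seqs (m - d) (d - 1)"
      then obtain \<beta> where b: "\<beta> \<in> ballot_seqs (m - d) (d - 1)" "S = set_of \<beta>"
        by blast
      then have w: "word S \<in> ballot_seqs (m - d) (d - 1)"
        using \<open>\<forall>\<beta>\<in>ballot_seqs (m - d) (d - 1). word (set_of \<beta>) = \<beta>\<close> by simp
      have Sm: "m \<in> S" "S \<subseteq> {1..m}"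
        using b(2) m by (auto simp: set_of_def)
      then have fin: "finite S"
        using finite_subset by blast
      have eq: "S \<inter> {1..m - 1} = S - {m}"
        using Sm by force
      have "card (S - {m}) = d - 1"
        using w ballot_word eq by metis
      then have cardS: "card S = d"
        using Sm(1) fin d by (metis Suc_diff_1 card.remove)
      moreover have "Max S = m"
        using Sm fin by (intro Max_eqI) auto
      moreover have "S \<in> admissible n"
        unfolding admissible_iff
      proof (intro conjI ballI)
        show "S \<subseteq> {1..n}"
          using Sm n by auto
        fix k assume k: "k \<in> {1..n}"
        show "card (S \<inter> {1..k}) < card ({1..k} - S)"
        proof (cases "k < m")
          case True
          then show ?thesis
            using w ballot_word k by auto
        next
          case False
          \<comment> \<open>From \<open>m\<close> on all \<open>d\<close> elements are counted, and
            \<open>k - d > d\<close> because \<open>k \<ge> m > 2 * d\<close>.\<close>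
          then have "S \<subseteq> {1..k}"
            using Sm by auto
          then have "S \<inter> {1..k} = S" "card ({1..k} - S) = k - d"
            using fin cardS by (auto simp: card_Diff_subset)
          then show ?thesis
            using cardS False m by simp
        qed
      qed
      ultimately show "S \<in> ?A"
        by simp
    qed
  qed
  then show ?thesis
    unfolding pin_count_def by (rule bij_betw_same_card)
qed

section \<open>Closed form of the polynomial\<close>

text \<open>Written as a falling factorial over \<open>fact (d - 1)\<close>, the binomial has the
  leading factor \<open>m - 1\<close>, which cancels the denominator and leaves the product from
  \<open>i = 2\<close>. For \<open>d = 1\<close> there is no such factor, and the fraction itself is
  1.\<close>

lemma poly_pin_poly_binomial:
  assumes d: "0 < d" and m: "1 < m"
  shows "poly (pin_poly d) (real m)
    = (real m - 2 * real d + 1) / (real m - 1) * real ((m - 1) choose (d - 1))"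
proof (cases "d = 1")
  case True
  then show ?thesis
    using m by (simp add: pin_poly_def)
next
  case False
  then have d2: "2 \<le> d"
    using d by simp
  have "real ((m - 1) choose (d - 1)) = (\<Prod>i = 0..<d - 1. (real m - 1) - real i) / fact (d - 1)"
    using m by (simp add: binomial_gbinomial gbinomial_prod_rev of_nat_diff)
  also have "(\<Prod>i = 0..<d - 1. (real m - 1) - real i) = (\<Prod>i = 1..d - 1. real m - real i)"
    using d2
    by (intro prod.reindex_bij_witness[of _ "\<lambda>i. i - 1" Suc]) (auto simp: of_nat_diff)
  also have "\<dots> = (real m - 1) * (\<Prod>i = 2..d - 1. real m - real i)"
    using d2 by (subst prod.atLeast_Suc_atMost) (auto simp: numeral_2_eq_2)
  finally show ?thesis
    using False m by (simp add: poly_pin_poly)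
qed

theorem theorem3p3:
  fixes m d n :: nat
  assumes "m > 0" and "d > 0" and "m > 2 * d" and "n \<ge> m"
  shows "real (pin_count n m d) = poly (pin_poly d) (real m) \<and>
         real (pin_count n m d)
           = (real m - 2 * real d + 1) / (real m - 1) * real ((m - 1) choose (d - 1)) \<and>
         (real m - 2 * real d + 1) / (real m - 1) * real ((m - 1) choose (d - 1))
           = real (card (ballot_seqs (m - d) (d - 1)))"
proof -
  \<comment> \<open>The ballot theorem with \<open>p = m - d\<close> and \<open>q = d - 1\<close>,
    so that \<open>p + q = m - 1\<close> and \<open>p - q = m - 2 * d + 1\<close>.\<close>
  have "real (card (ballot_seqs (m - d) (d - 1)))
      = (real (m - d) - real (d - 1)) / real (m - d + (d - 1)) * real ((m - d + (d - 1)) choose (d - 1))"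
    using assms by (intro card_ballot_seqs) auto
  moreover have "m - d + (d - 1) = m - 1"
    using assms by simp
  moreover have "real (m - d) - real (d - 1) = real m - 2 * real d + 1" "real (m - 1) = real m - 1"
    using assms by (auto simp: of_nat_diff)
  ultimately have "real (card (ballot_seqs (m - d) (d - 1)))
      = (real m - 2 * real d + 1) / (real m - 1) * real ((m - 1) choose (d - 1))"
    by simp
  moreover have "pin_count n m d = card (ballot_seqs (m - d) (d - 1))"
    using assms by (intro pin_count_eq_card_ballot_seqs) auto
  moreover have "poly (pin_poly d) (real m)
      = (real m - 2 * real d + 1) / (real m - 1) * real ((m - 1) choose (d - 1))"
    using assms by (intro poly_pin_poly_binomial) auto
  ultimately show ?thesis
    by simp
qed

end
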